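(* Let $G$ be a finite group, $g\ge0$, $U\le G$ a subgroup, and $O=\{aUa^{-1}\mid a\in G\}$ its conjugacy class. Let $C$ and $N$ be the centralizer and normalizer of $U$ in $G$, and $Z=N/C$. The map $$\varphi\colon G/C\times\Omega^g_U\to\Omega^g(O),\quad(aC,f)\mapsto\bigl([\gamma]\mapsto af([\gamma])a^{-1}\bigr)$$ descends to a bijection between $G/C\times_Z\Omega^g_U$ and $\Omega^g(O)$ that is equivariant with respect to both the $G$-action and the $\Gamma_g(x)$-action.
   Context: $\Sigma_g$ is the closed oriented surface of genus $g$ with base point $x$, $\Gamma_g(x)$ is the group of isotopy classes of orientation-preserving diffeomorphisms of $\Sigma_g$ fixing $x$ (isotopies fixing $x$), and $\Omega^g=\mathrm{Hom}(\pi_1(\Sigma_g,x),G)$. $\Gamma_g(x)$ acts on $\Omega^g$ by $([\psi].f)([\gamma])=f([\psi^{-1}\circ\gamma])$, and $G$ acts by $(a.f)([\gamma])=af([\gamma])a^{-1}$. For a subgroup $V\le G$, $\Omega^g_V=\{f\in\Omega^g\mid\mathrm{im}(f)=V\}$, and $\Omega^g(O)=\bigcup_{V\in O}\Omega^g_V$. $C$ is normal in $N$. The group $Z=N/C$ acts on $\Omega^g_U$ from the left by conjugation: $((bC).f)([\gamma])=bf([\gamma])b^{-1}$ for $b\in N$; and on the left coset space $G/C$ from the right by $(aC).(bC)=abC$. The left action of $Z$ on $G/C\times\Omega^g_U$ is $z.(aC,f)=((aC).z^{-1},z.f)$, and $G/C\times_Z\Omega^g_U$ denotes its set of orbits. $G$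 acts on $G/C\times\Omega^g_U$ by left translation on $G/C$, and $\Gamma_g(x)$ acts through its action on $\Omega^g_U$; these actions commute with $Z$ and descend to $G/C\times_Z\Omega^g_U$. *)

theory Defs
  imports "HOL-Analysis.Analysis" "HOL-Homology.Homology" "HOL-Algebra.Left_Coset" "HOL-Algebra.Group_Action"
begin

section \<open>Smooth maps between subsets of Euclidean spaces\<close>

text \<open>Meaningful for open \<open>S\<close>; \<^term>\<open>continuous_on\<close> at the last stage makes this the usual
  class of \<open>k\<close> times continuously differentiable maps when the domain is finite-dimensional.\<close>

primrec Ck_on :: "nat \<Rightarrow> 'a::real_normed_vector set \<Rightarrow> ('a \<Rightarrow> 'b::real_normed_vector) \<Rightarrow> bool" where
  "Ck_on 0 S f \<longleftrightarrow> continuous_on S f"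
| "Ck_on (Suc k) S f \<longleftrightarrow>
     (\<forall>p\<in>S. f differentiable (at p)) \<and> (\<forall>v. Ck_on k S (\<lambda>p. frechet_derivative f (at p) v))"

text \<open>Smoothness on an arbitrary set means local extendability to a smooth map on an open set.
  The general form is needed for isotopies, which are parametrised by the closed unit interval.\<close>

definition smooth_on :: "'a::real_normed_vector set \<Rightarrow> ('a \<Rightarrow> 'b::real_normed_vector) \<Rightarrow> bool" where
  "smooth_on S f \<longleftrightarrow>
     (\<forall>p\<in>S. \<exists>T f'. open T \<and> p \<in> T \<and> (\<forall>k. Ck_on k T f') \<and> (\<forall>q\<in>S \<inter> T. f' q = f q))"


section \<open>Closed oriented surfaces\<close>

text \<open>A chart of a surface \<open>M\<close> is a pair of an open subset of \<open>M\<close> and a map into the plane.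
  Only the values of functions on \<open>M\<close> (and of charts on their domain) matter.\<close>

type_synonym 'm chart = "'m set \<times> ('m \<Rightarrow> real^2)"

definition chart_on :: "'m::t2_space set \<Rightarrow> 'm chart \<Rightarrow> bool" where
  "chart_on M = (\<lambda>(U, h). openin (top_of_set M) U \<and> open (h ` U) \<and>
     (\<exists>h'. homeomorphism U (h ` U) h h'))"

definition coord_dom :: "('m \<Rightarrow> 'm) \<Rightarrow> 'm chart \<Rightarrow> 'm chart \<Rightarrow> (real^2) set" where
  "coord_dom f = (\<lambda>(U, h) (V, k). h ` (U \<inter> f -` V))"

definition coord_rep :: "('m \<Rightarrow> 'm) \<Rightarrow> 'm chart \<Rightarrow> 'm chart \<Rightarrow> real^2 \<Rightarrow> real^2" where
  "coord_rep f = (\<lambda>(U, h) (V, k). k \<circ> f \<circ> inv_into U h)"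

definition smooth_self_map :: "'m::t2_space set \<Rightarrow> 'm chart set \<Rightarrow> ('m \<Rightarrow> 'm) \<Rightarrow> bool" where
  "smooth_self_map M A f \<longleftrightarrow> f \<in> M \<rightarrow> M \<and> continuous_on M f \<and>
     (\<forall>c\<in>A. \<forall>d\<in>A. smooth_on (coord_dom f c d) (coord_rep f c d))"

definition positive_jacobian :: "'m chart set \<Rightarrow> ('m \<Rightarrow> 'm) \<Rightarrow> bool" where
  "positive_jacobian A f \<longleftrightarrow> (\<forall>c\<in>A. \<forall>d\<in>A. \<forall>y\<in>coord_dom f c d.
     det (matrix (frechet_derivative (coord_rep f c d) (at y))) > 0)"

text \<open>The coordinate representations of the identity are the transition maps of the atlas.\<close>

definition oriented_atlas :: "'m::t2_space set \<Rightarrow> 'm chart set \<Rightarrow> bool" where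
  "oriented_atlas M A \<longleftrightarrow> (\<forall>c\<in>A. chart_on M c) \<and> (\<Union>c\<in>A. fst c) = M \<and>
     smooth_self_map M A id \<and> positive_jacobian A id"

text \<open>The genus \<open>g\<close> is recorded by the first homology group being free abelian of rank \<open>2 * g\<close>.\<close>

definition closed_oriented_surface :: "'m::t2_space set \<Rightarrow> 'm chart set \<Rightarrow> nat \<Rightarrow> bool" where
  "closed_oriented_surface M A g \<longleftrightarrow>
     M \<noteq> {} \<and> compact M \<and> connected M \<and> oriented_atlas M A \<and>
     homology_group 1 (top_of_set M) \<cong> free_Abelian_group {..<2 * g}"


section \<open>Functions on classes\<close>

text \<open>The common value on the class \<open>S\<close> of a function that is constant on \<open>S\<close>.\<close>

definition descend :: "('a \<Rightarrow> 'b) \<Rightarrow> 'a set \<Rightarrow> 'b" where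
  "descend h S = the_elem (h ` S)"


section \<open>Mapping class group and fundamental group\<close>

definition pointed_diffeos :: "'m::t2_space set \<Rightarrow> 'm chart set \<Rightarrow> 'm \<Rightarrow> ('m \<Rightarrow> 'm) set" where
  "pointed_diffeos M A x = {\<psi>. bij_betw \<psi> M M \<and> smooth_self_map M A \<psi> \<and>
     smooth_self_map M A (inv_into M \<psi>) \<and> positive_jacobian A \<psi> \<and> \<psi> x = x}"

definition isotopy :: "'m::t2_space set \<Rightarrow> 'm chart set \<Rightarrow> 'm \<Rightarrow> (('m \<Rightarrow> 'm) \<times> ('m \<Rightarrow> 'm)) set" where
  "isotopy M A x = {(\<psi>, \<psi>'). \<psi> \<in> pointed_diffeos M A x \<and> \<psi>' \<in> pointed_diffeos M A x \<and>
     (\<exists>F :: real \<Rightarrow> 'm \<Rightarrow> 'm.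
        (\<forall>t\<in>{0..1}. F t \<in> pointed_diffeos M A x) \<and>
        continuous_on ({0..1} \<times> M) (\<lambda>(t, y). F t y) \<and>
        (\<forall>(U, h)\<in>A. \<forall>(V, k)\<in>A.
           smooth_on {(t, y). t \<in> {0..1} \<and> y \<in> h ` U \<and> F t (inv_into U h y) \<in> V}
                     (\<lambda>(t, y). k (F t (inv_into U h y)))) \<and>
        (\<forall>y\<in>M. F 0 y = \<psi> y) \<and> (\<forall>y\<in>M. F 1 y = \<psi>' y))}"

definition mapping_class_group :: "'m::t2_space set \<Rightarrow> 'm chart set \<Rightarrow> 'm \<Rightarrow> ('m \<Rightarrow> 'm) set monoid" where
  "mapping_class_group M A x =
     \<lparr>carrier = pointed_diffeos M A x // isotopy M A x,
      monoid.mult = (\<lambda>\<Phi> \<Psi>. descend (\<lambda>(\<phi>, \<psi>). isotopy M A x `` {\<phi> \<circ> \<psi>}) (\<Phi> \<times> \<Psi>)),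
      one = isotopy M A x `` {id}\<rparr>"

definition loop_class :: "'m::t2_space set \<Rightarrow> (real \<Rightarrow> 'm) \<Rightarrow> (real \<Rightarrow> 'm) set" where
  "loop_class M \<gamma> = {\<delta>. homotopic_paths M \<gamma> \<delta>}"

definition fundamental_group :: "'m::t2_space set \<Rightarrow> 'm \<Rightarrow> (real \<Rightarrow> 'm) set monoid" where
  "fundamental_group M x =
     \<lparr>carrier = {loop_class M \<gamma> | \<gamma>.
        path \<gamma> \<and> path_image \<gamma> \<subseteq> M \<and> pathstart \<gamma> = x \<and> pathfinish \<gamma> = x},
      monoid.mult = (\<lambda>c d. descend (\<lambda>(\<gamma>, \<delta>). loop_class M (\<gamma> +++ \<delta>)) (c \<times> d)),
      one = loop_class M (\<lambda>_. x)\<rparr>"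


section \<open>Homomorphisms and their symmetries\<close>

text \<open>Homomorphisms are represented by extensional functions, so that equality of
  homomorphisms is equality of functions.\<close>

definition Hom :: "('p, 'q) monoid_scheme \<Rightarrow> ('g, 'h) monoid_scheme \<Rightarrow> ('p \<Rightarrow> 'g) set" where
  "Hom P G = hom P G \<inter> extensional (carrier P)"

definition Hom_onto :: "('p, 'q) monoid_scheme \<Rightarrow> ('g, 'h) monoid_scheme \<Rightarrow> 'g set \<Rightarrow> ('p \<Rightarrow> 'g) set" where
  "Hom_onto P G V = {f \<in> Hom P G. f ` carrier P = V}"

definition conj_class :: "('g, 'h) monoid_scheme \<Rightarrow> 'g set \<Rightarrow> 'g set set" where
  "conj_class G U = {(\<lambda>u. a \<otimes>\<^bsub>G\<^esub> u \<otimes>\<^bsub>G\<^esub> inv\<^bsub>G\<^esub> a) ` U | a. a \<in> carrier G}"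

definition Hom_onto_class ::
  "('p, 'q) monoid_scheme \<Rightarrow> ('g, 'h) monoid_scheme \<Rightarrow> 'g set set \<Rightarrow> ('p \<Rightarrow> 'g) set" where
  "Hom_onto_class P G O' = (\<Union>V\<in>O'. Hom_onto P G V)"

definition centralizer :: "('g, 'h) monoid_scheme \<Rightarrow> 'g set \<Rightarrow> 'g set" where
  "centralizer G U = {a \<in> carrier G. \<forall>u\<in>U. a \<otimes>\<^bsub>G\<^esub> u = u \<otimes>\<^bsub>G\<^esub> a}"

definition conj_act ::
  "('p, 'q) monoid_scheme \<Rightarrow> ('g, 'h) monoid_scheme \<Rightarrow> 'g \<Rightarrow> ('p \<Rightarrow> 'g) \<Rightarrow> ('p \<Rightarrow> 'g)" where
  "conj_act P G a f = (\<lambda>c\<in>carrier P. a \<otimes>\<^bsub>G\<^esub> f c \<otimes>\<^bsub>G\<^esub> inv\<^bsub>G\<^esub> a)"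

definition mcg_act ::
  "'m::t2_space set \<Rightarrow> 'm \<Rightarrow> ('m \<Rightarrow> 'm) set \<Rightarrow> ((real \<Rightarrow> 'm) set \<Rightarrow> 'g) \<Rightarrow> ((real \<Rightarrow> 'm) set \<Rightarrow> 'g)" where
  "mcg_act M x \<Phi> f = descend (\<lambda>\<psi>. \<lambda>c\<in>carrier (fundamental_group M x).
     descend (\<lambda>\<gamma>. f (loop_class M (inv_into M \<psi> \<circ> \<gamma>))) c) \<Phi>"


section \<open>The balanced product\<close>

text \<open>\<open>Mod\<close> consists of right cosets \<open>Cb\<close>; these equal \<open>bC\<close> since \<open>C\<close> is normal in the normalizer.\<close>

definition Weyl :: "('g, 'h) monoid_scheme \<Rightarrow> 'g set \<Rightarrow> 'g set monoid" where
  "Weyl G U = (G\<lparr>carrier := normalizer G U\<rparr>) Mod centralizer G U"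

definition coset_right_act :: "('g, 'h) monoid_scheme \<Rightarrow> 'g set \<Rightarrow> 'g set \<Rightarrow> 'g set \<Rightarrow> 'g set" where
  "coset_right_act G C aC z = descend (\<lambda>(a, b). (a \<otimes>\<^bsub>G\<^esub> b) <#\<^bsub>G\<^esub> C) (aC \<times> z)"

definition Weyl_act ::
  "('p, 'q) monoid_scheme \<Rightarrow> ('g, 'h) monoid_scheme \<Rightarrow> 'g set \<Rightarrow> 'g set
     \<Rightarrow> 'g set \<times> ('p \<Rightarrow> 'g) \<Rightarrow> 'g set \<times> ('p \<Rightarrow> 'g)" where
  "Weyl_act P G U z = (\<lambda>(aC, f).
     (coset_right_act G (centralizer G U) aC (inv\<^bsub>Weyl G U\<^esub> z), descend (\<lambda>b. conj_act P G b f) z))"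

definition balanced_product ::
  "('p, 'q) monoid_scheme \<Rightarrow> ('g, 'h) monoid_scheme \<Rightarrow> 'g set \<Rightarrow> ('g set \<times> ('p \<Rightarrow> 'g)) set set" where
  "balanced_product P G U =
     orbits (Weyl G U) ((lcosets\<^bsub>G\<^esub> (centralizer G U)) \<times> Hom_onto P G U) (Weyl_act P G U)"

text \<open>The self-map of the orbit set induced by a self-map commuting with the orbit relation.\<close>

definition on_orbits ::
  "('p, 'q) monoid_scheme \<Rightarrow> ('g, 'h) monoid_scheme \<Rightarrow> 'g set
     \<Rightarrow> ('g set \<times> ('p \<Rightarrow> 'g) \<Rightarrow> 'g set \<times> ('p \<Rightarrow> 'g))
     \<Rightarrow> ('g set \<times> ('p \<Rightarrow> 'g)) set \<Rightarrow> ('g set \<times> ('p \<Rightarrow> 'g)) set" where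
  "on_orbits P G U \<alpha> = descend (\<lambda>p. orbit (Weyl G U) (Weyl_act P G U) (\<alpha> p))"

definition phi_map ::
  "('p, 'q) monoid_scheme \<Rightarrow> ('g, 'h) monoid_scheme \<Rightarrow> 'g set \<times> ('p \<Rightarrow> 'g) \<Rightarrow> ('p \<Rightarrow> 'g)" where
  "phi_map P G = (\<lambda>(aC, f). descend (\<lambda>a. conj_act P G a f) aC)"

definition phi_bar ::
  "('p, 'q) monoid_scheme \<Rightarrow> ('g, 'h) monoid_scheme \<Rightarrow> ('g set \<times> ('p \<Rightarrow> 'g)) set \<Rightarrow> ('p \<Rightarrow> 'g)" where
  "phi_bar P G = descend (phi_map P G)"

end

theory Submission
  imports Defs
begin

text \<open>
  Everything rests on one computation: the \<open>Z\<close>-orbits on \<open>G/C \<times> \<Omega>\<^sub>U\<close> are exactly the fibres of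
  \<open>\<phi>\<close>. That \<open>\<phi>\<close> is constant on orbits is the cancellation \<open>(a b\<inverse>) (b f b\<inverse>) (a b\<inverse>)\<inverse> = a f a\<inverse>\<close>.
  Conversely, if \<open>a f a\<inverse> = a' f' a'\<inverse>\<close>, put \<open>b = a'\<inverse> a\<close>. Then \<open>f' = b f b\<inverse>\<close>, and since \<open>f\<close> and
  \<open>f'\<close> both have image \<open>U\<close>, the element \<open>b\<close> normalizes \<open>U\<close>; its class in \<open>Z\<close> carries \<open>(aC, f)\<close> to
  \<open>(a b\<inverse> C, b f b\<inverse>) = (a' C, f')\<close>. This is \<open>orbit_eq_fibre\<close>. A map always induces a bijection from
  the set of its fibres onto its image, and the image of \<open>\<phi>\<close> is \<open>\<Omega>(O)\<close> because a homomorphism onto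
  \<open>a U a\<inverse>\<close> is conjugated by \<open>a\<inverse>\<close> to one onto \<open>U\<close>.

  Equivariance comes from the same description of the orbits: a self-map \<open>\<alpha>\<close> of
  \<open>G/C \<times> \<Omega>\<^sub>U\<close> with \<open>\<phi> \<circ> \<alpha> = \<beta> \<circ> \<phi>\<close> maps fibres into fibres (\<open>phi_bar_equivariant\<close>). For the left
  translations by \<open>G\<close> such an identity is immediate. For the mapping class group, the surface enters
  in one way only: a mapping class acts on homomorphisms by precomposition with an automorphism of
  the fundamental group (\<open>mcg_act_eq_precomposition\<close>), and precomposition commutes with
  conjugating values and does not change images. The topological content is that this automorphism,
  \<open>[\<gamma>] \<mapsto> [\<psi>\<inverse> \<circ> \<gamma>]\<close>, depends only on the isotopy class of \<open>\<psi>\<close>.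
\<close>


section \<open>Functions on fibres\<close>

lemma descend_eq:
  assumes "s \<in> S" and "\<And>t. t \<in> S \<Longrightarrow> h t = h s"
  shows "descend h S = h s"
proof -
  have "h ` S = {h s}"
    using assms by blast
  then show ?thesis
    by (simp add: descend_def)
qed

lemma bij_betw_descend_fibres:
  assumes "\<And>p. p \<in> E \<Longrightarrow> R p = {q \<in> E. h q = h p}"
  shows "bij_betw (descend h) {R p | p. p \<in> E} (h ` E)"
proof -
  have val: "descend h (R p) = h p" if "p \<in> E" for p
    using that assms[OF that] by (intro descend_eq) auto
  have "inj_on (descend h) {R p | p. p \<in> E}"
    using assms val by (auto simp: inj_on_def)
  moreover have "descend h ` {R p | p. p \<in> E} = h ` E"
    using val by (auto simp: image_iff) metis+
  ultimately show ?thesis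
    by (simp add: bij_betw_def)
qed

section \<open>Conjugating homomorphisms\<close>

lemma Hom_onto_closed: "f \<in> Hom_onto P G V \<Longrightarrow> c \<in> carrier P \<Longrightarrow> f c \<in> V"
  by (auto simp: Hom_onto_def)

context group
begin

lemma conj_act_conj_act:
  assumes "a \<in> carrier G" "b \<in> carrier G" and "f \<in> carrier P \<rightarrow> carrier G"
  shows "conj_act P G a (conj_act P G b f) = conj_act P G (a \<otimes> b) f"
proof
  fix c
  show "conj_act P G a (conj_act P G b f) c = conj_act P G (a \<otimes> b) f c"
  proof (cases "c \<in> carrier P")
    case True
    then have "f c \<in> carrier G"
      using assms by auto
    then show ?thesis
      using True assms by (simp add: conj_act_def inv_mult_group m_assoc)
  qed (simp add: conj_act_def)
qed

lemma conj_act_one: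
  assumes "f \<in> carrier P \<rightarrow> carrier G" and "f \<in> extensional (carrier P)"
  shows "conj_act P G \<one> f = f"
  using assms by (auto simp: conj_act_def fun_eq_iff extensional_def Pi_def)

lemma conj_act_Hom_onto:
  assumes closed: "\<And>c d. c \<in> carrier P \<Longrightarrow> d \<in> carrier P \<Longrightarrow> c \<otimes>\<^bsub>P\<^esub> d \<in> carrier P"
    and a: "a \<in> carrier G" and f: "f \<in> Hom_onto P G V"
  shows "conj_act P G a f \<in> Hom_onto P G ((\<lambda>u. a \<otimes> u \<otimes> inv a) ` V)"
proof -
  have fc: "f c \<in> carrier G" if "c \<in> carrier P" for c
    using that f by (auto simp: Hom_onto_def Hom_def hom_def)
  have "conj_act P G a f (c \<otimes>\<^bsub>P\<^esub> d) = conj_act P G a f c \<otimes> conj_act P G a f d"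
    if cd: "c \<in> carrier P" "d \<in> carrier P" for c d
  proof -
    have "f (c \<otimes>\<^bsub>P\<^esub> d) = f c \<otimes> f d"
      using f cd by (auto simp: Hom_onto_def Hom_def hom_def)
    moreover have "inv a \<otimes> (a \<otimes> (f d \<otimes> inv a)) = f d \<otimes> inv a"
      using a fc cd by (simp flip: m_assoc)
    ultimately show ?thesis
      using a fc cd closed by (simp add: conj_act_def m_assoc)
  qed
  then have "conj_act P G a f \<in> hom P G"
    using a fc by (auto simp: hom_def conj_act_def)
  moreover have "conj_act P G a f ` carrier P = (\<lambda>u. a \<otimes> u \<otimes> inv a) ` V"
    using f by (auto simp: Hom_onto_def conj_act_def)
  ultimately show ?thesis
    by (auto simp: Hom_onto_def Hom_def conj_act_def)
qed

section \<open>Normalizer and centralizer\<close>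

text \<open>In this form the normalizer consists visibly of the elements that conjugate homomorphisms onto
  \<open>U\<close> to homomorphisms onto \<open>U\<close>.\<close>

lemma normalizer_iff:
  assumes "U \<subseteq> carrier G"
  shows "b \<in> normalizer G U \<longleftrightarrow> b \<in> carrier G \<and> (\<lambda>u. b \<otimes> u \<otimes> inv b) ` U = U"
proof -
  have "b <#\<^bsub>G\<^esub> U #> inv b = (\<lambda>u. b \<otimes> u \<otimes> inv b) ` U"
    by (auto simp: l_coset_def r_coset_def)
  then show ?thesis
    using assms by (simp add: normalizer_def stabilizer_def)
qed

lemma subgroup_centralizer:
  assumes "U \<subseteq> carrier G"
  shows "subgroup (centralizer G U) G"
proof (rule subgroupI)
  show "centralizer G U \<subseteq> carrier G"
    by (auto simp: centralizer_def)
  show "centralizer G U \<noteq> {}"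
    using assms by (auto simp: centralizer_def intro!: exI[of _ \<one>])
next
  fix a assume a: "a \<in> centralizer G U"
  have "inv a \<otimes> u = u \<otimes> inv a" if "u \<in> U" for u
  proof -
    have G: "a \<in> carrier G" "u \<in> carrier G" "a \<otimes> u = u \<otimes> a"
      using a that assms by (auto simp: centralizer_def)
    have "inv a \<otimes> u = inv a \<otimes> (u \<otimes> a) \<otimes> inv a"
      using G(1,2) by (simp add: m_assoc)
    also have "\<dots> = inv a \<otimes> (a \<otimes> u) \<otimes> inv a"
      using G by simp
    also have "\<dots> = u \<otimes> inv a"
      using G(1,2) by (simp flip: m_assoc)
    finally show ?thesis .
  qed
  then show "inv a \<in> centralizer G U"
    using a by (auto simp: centralizer_def)
next
  fix a b assume ab: "a \<in> centralizer G U" "b \<in> centralizer G U"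
  have "a \<otimes> b \<otimes> u = u \<otimes> (a \<otimes> b)" if "u \<in> U" for u
  proof -
    have "a \<in> carrier G" "b \<in> carrier G" "u \<in> carrier G" "a \<otimes> u = u \<otimes> a" "b \<otimes> u = u \<otimes> b"
      using ab that assms by (auto simp: centralizer_def)
    then show ?thesis
      by (metis m_assoc)
  qed
  then show "a \<otimes> b \<in> centralizer G U"
    using ab by (auto simp: centralizer_def)
qed

lemma centralizer_conj:
  assumes U: "U \<subseteq> carrier G" and c: "c \<in> centralizer G U" and "u \<in> U"
  shows "c \<otimes> u \<otimes> inv c = u"
proof -
  have "c \<in> carrier G" "u \<in> carrier G" "c \<otimes> u = u \<otimes> c"
    using assms by (auto simp: centralizer_def)
  then show ?thesis
    by (simp add: m_assoc)
qed

text \<open>The centralizer is the kernel of the conjugation action of the normalizer on \<open>U\<close>. The proof writes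
  \<open>u\<close> as \<open>b v b\<inverse>\<close> with \<open>v\<close> in \<open>U\<close>, so that commuting with \<open>u\<close> after conjugation by \<open>b\<close> is
  commuting with \<open>v\<close> before it.\<close>

lemma centralizer_normal_in_normalizer:
  assumes U: "U \<subseteq> carrier G"
  shows "centralizer G U \<lhd> G\<lparr>carrier := normalizer G U\<rparr>"
proof -
  let ?C = "centralizer G U" and ?N = "normalizer G U"
  have N: "subgroup ?N G"
    using U by (rule normalizer_imp_subgroup)
  have "?C \<subseteq> ?N"
  proof
    fix c assume c: "c \<in> ?C"
    then have "(\<lambda>u. c \<otimes> u \<otimes> inv c) ` U = U"
      using centralizer_conj[OF U] by simp
    then show "c \<in> ?N"
      using c normalizer_iff[OF U] by (auto simp: centralizer_def)
  qed
  then have sub: "subgroup ?C (G\<lparr>carrier := ?N\<rparr>)"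
    using subgroup_incl[OF subgroup_centralizer[OF U] N] by simp
  have conj: "b \<otimes> c \<otimes> inv b \<in> ?C" if b: "b \<in> ?N" and c: "c \<in> ?C" for b c
  proof -
    have G: "b \<in> carrier G" "c \<in> carrier G"
      using b c normalizer_iff[OF U] by (auto simp: centralizer_def)
    have "(b \<otimes> c \<otimes> inv b) \<otimes> u = u \<otimes> (b \<otimes> c \<otimes> inv b)" if u: "u \<in> U" for u
    proof -
      obtain v where v: "v \<in> U" and u_eq: "u = b \<otimes> v \<otimes> inv b"
        using b u normalizer_iff[OF U] by blast
      have v': "v \<in> carrier G" "c \<otimes> v = v \<otimes> c"
        using v c U by (auto simp: centralizer_def)
      have cancel: "inv b \<otimes> (b \<otimes> w) = w" if "w \<in> carrier G" for w
        using that G by (simp flip: m_assoc)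
      have "c \<otimes> (v \<otimes> inv b) = v \<otimes> (c \<otimes> inv b)"
        using v' G by (metis inv_closed m_assoc)
      then show ?thesis
        using v' G by (simp add: u_eq m_assoc cancel)
    qed
    then show ?thesis
      using G by (simp add: centralizer_def)
  qed
  interpret N: group "G\<lparr>carrier := ?N\<rparr>"
    using N by (rule subgroup_imp_group)
  show ?thesis
    unfolding N.normal_inv_iff using sub conj by (auto simp: m_inv_consistent[OF N])
qed

end

section \<open>The orbits of the balanced product are the fibres of the map\<close>

text \<open>The conjugate of a homomorphism is made \<open>undefined\<close> off the carrier of \<open>P\<close>. The carrier being
  closed under multiplication ensures that its value at a product is still the conjugated one.\<close>

locale homs_onto_conjugates = group G
  for G :: "('g, 'h) monoid_scheme" (structure) and P :: "('p, 'q) monoid_scheme" and U +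
  assumes U: "U \<subseteq> carrier G"
    and closed: "\<And>c d. c \<in> carrier P \<Longrightarrow> d \<in> carrier P \<Longrightarrow> c \<otimes>\<^bsub>P\<^esub> d \<in> carrier P"
begin

abbreviation "C \<equiv> centralizer G U"
abbreviation "N \<equiv> normalizer G U"
abbreviation "E \<equiv> (lcosets C) \<times> Hom_onto P G U"

lemma Hom_onto_Pi: "f \<in> Hom_onto P G U \<Longrightarrow> f \<in> carrier P \<rightarrow> carrier G"
  using U by (auto simp: Hom_onto_def)

lemma Hom_onto_extensional: "f \<in> Hom_onto P G V \<Longrightarrow> f \<in> extensional (carrier P)"
  by (simp add: Hom_onto_def Hom_def)

lemma C_subgroup: "subgroup C G"
  using U by (rule subgroup_centralizer)

lemma C_carrier: "c \<in> C \<Longrightarrow> c \<in> carrier G"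
  by (simp add: centralizer_def)

lemma N_carrier: "b \<in> N \<Longrightarrow> b \<in> carrier G"
  using normalizer_iff[OF U] by blast

text \<open>The reason why \<open>\<phi>\<close> and the action of \<open>Z\<close> are well defined on cosets of \<open>C\<close>: a homomorphism into
  \<open>U\<close> is fixed by the centralizer of \<open>U\<close>.\<close>

lemma conj_act_centralizer:
  assumes "c \<in> C" and f: "f \<in> Hom_onto P G U"
  shows "conj_act P G c f = f"
proof
  fix d
  show "conj_act P G c f d = f d"
    using centralizer_conj[OF U assms(1) Hom_onto_closed[OF f]] Hom_onto_extensional[OF f]
    by (auto simp: conj_act_def extensional_def)
qed

lemma conj_act_coset:
  assumes "a \<in> carrier G" "c \<in> C" "f \<in> Hom_onto P G U"
  shows "conj_act P G (a \<otimes> c) f = conj_act P G a f"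
  using conj_act_conj_act[of a c f P] assms Hom_onto_Pi C_carrier conj_act_centralizer by metis

lemma lcoset_self: "a \<in> carrier G \<Longrightarrow> a \<in> a <#\<^bsub>G\<^esub> C"
  by (rule lcos_self[OF _ C_subgroup])

lemma lcoset_mult_C: "a \<in> carrier G \<Longrightarrow> c \<in> C \<Longrightarrow> (a \<otimes> c) <#\<^bsub>G\<^esub> C = a <#\<^bsub>G\<^esub> C"
  using l_repr_independence[OF _ _ C_subgroup, of "a \<otimes> c" a] by (auto simp: l_coset_def)

lemma E_cases:
  assumes "p \<in> E"
  obtains a f where "a \<in> carrier G" "f \<in> Hom_onto P G U" "p = (a <#\<^bsub>G\<^esub> C, f)"
  using assms by (auto simp: LCOSETS_def)

lemma E_I: "a \<in> carrier G \<Longrightarrow> f \<in> Hom_onto P G U \<Longrightarrow> (a <#\<^bsub>G\<^esub> C, f) \<in> E"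
  by (auto simp: LCOSETS_def)

lemma phi_map_eq:
  assumes "a \<in> carrier G" "f \<in> Hom_onto P G U"
  shows "phi_map P G (a <#\<^bsub>G\<^esub> C, f) = conj_act P G a f"
  using assms conj_act_coset lcoset_self
  by (auto simp: phi_map_def l_coset_def intro!: descend_eq)

lemma phi_map_in_conj_class:
  assumes "p \<in> E"
  shows "phi_map P G p \<in> Hom_onto_class P G (conj_class G U)"
proof -
  obtain a f where p: "a \<in> carrier G" "f \<in> Hom_onto P G U" "p = (a <#\<^bsub>G\<^esub> C, f)"
    using assms by (rule E_cases)
  then show ?thesis
    using conj_act_Hom_onto[OF closed, of a f U]
    by (auto simp: Hom_onto_class_def conj_class_def phi_map_eq)
qed

text \<open>Surjectivity of \<open>\<phi>\<close>: a homomorphism \<open>f'\<close> onto \<open>a U a\<inverse>\<close> comes from \<open>(aC, a\<inverse> f' a)\<close>.\<close>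

lemma phi_map_image: "phi_map P G ` E = Hom_onto_class P G (conj_class G U)"
proof (intro equalityI subsetI)
  fix f' assume "f' \<in> Hom_onto_class P G (conj_class G U)"
  then obtain a where a: "a \<in> carrier G"
    and f': "f' \<in> Hom_onto P G ((\<lambda>u. a \<otimes> u \<otimes> inv a) ` U)"
    by (auto simp: Hom_onto_class_def conj_class_def)
  define f where "f = conj_act P G (inv a) f'"
  have "inv a \<otimes> (a \<otimes> u \<otimes> inv a) \<otimes> inv (inv a) = u" if "u \<in> U" for u
  proof -
    have "u \<in> carrier G"
      using that U by auto
    then show ?thesis
      using a by (simp add: m_assoc inv_solve_left')
  qed
  then have "(\<lambda>u. inv a \<otimes> u \<otimes> inv (inv a)) ` (\<lambda>u. a \<otimes> u \<otimes> inv a) ` U = U"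
    by (simp add: image_image)
  then have f: "f \<in> Hom_onto P G U"
    using conj_act_Hom_onto[OF closed _ f', of "inv a"] a by (simp add: f_def)
  have "f' \<in> carrier P \<rightarrow> carrier G"
    using f' by (auto simp: Hom_onto_def Hom_def hom_def)
  then have "conj_act P G a f = f'"
    using a f' conj_act_conj_act[of a "inv a" f' P] conj_act_one[of f' P] Hom_onto_extensional
    by (simp add: f_def)
  then show "f' \<in> phi_map P G ` E"
    using phi_map_eq[OF a f] E_I[OF a f] by force
qed (use phi_map_in_conj_class in auto)

lemma carrier_Weyl: "carrier (Weyl G U) = {C #> b | b. b \<in> N}"
  by (auto simp: Weyl_def carrier_FactGroup r_coset_def)

lemma inv_Weyl:
  assumes "b \<in> N"
  shows "inv\<^bsub>Weyl G U\<^esub> (C #> b) = C #> inv b"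
proof -
  note normal = centralizer_normal_in_normalizer[OF U]
  have N: "subgroup N G"
    using U by (rule normalizer_imp_subgroup)
  have "C #> b = C #>\<^bsub>G\<lparr>carrier := N\<rparr>\<^esub> b" for b
    by (simp add: r_coset_def)
  then show ?thesis
    using assms normal.rcos_inv[OF normal, of b] normal.inv_FactGroup[OF normal, of "C #> b"]
    by (auto simp: Weyl_def carrier_FactGroup m_inv_consistent[OF N])
qed

text \<open>Elements of \<open>Z\<close> are right cosets and elements of \<open>G/C\<close> left cosets; normality lets the formulas
  for the action be computed with either kind.\<close>

lemma rcoset_eq_lcoset: "b \<in> N \<Longrightarrow> C #> b = b <#\<^bsub>G\<^esub> C"
proof -
  assume b: "b \<in> N"
  note normal = centralizer_normal_in_normalizer[OF U]
  show ?thesis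
    using normal.coset_eq[OF normal] b by (simp add: r_coset_def l_coset_def)
qed

text \<open>The action on representatives. Independence of the choices in \<open>aC\<close> and \<open>C b\<inverse>\<close> uses
  \<open>C b\<inverse> = b\<inverse> C\<close> to move the centralizing factors to the right of \<open>a b\<inverse>\<close>, where the coset absorbs
  them.\<close>

lemma Weyl_act_eq:
  assumes a: "a \<in> carrier G" and f: "f \<in> Hom_onto P G U" and b: "b \<in> N"
  shows "Weyl_act P G U (C #> b) (a <#\<^bsub>G\<^esub> C, f) = ((a \<otimes> inv b) <#\<^bsub>G\<^esub> C, conj_act P G b f)"
proof -
  have N: "subgroup N G"
    using U by (rule normalizer_imp_subgroup)
  have b': "inv b \<in> N" "b \<in> carrier G"
    using b N N_carrier by (auto simp: subgroup.m_inv_closed)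
  have "coset_right_act G C (a <#\<^bsub>G\<^esub> C) (C #> inv b) = (a \<otimes> inv b) <#\<^bsub>G\<^esub> C"
  proof -
    have "descend (\<lambda>(a, b). (a \<otimes> b) <#\<^bsub>G\<^esub> C) ((a <#\<^bsub>G\<^esub> C) \<times> (C #> inv b))
        = (\<lambda>(a, b). (a \<otimes> b) <#\<^bsub>G\<^esub> C) (a, inv b)"
    proof (rule descend_eq)
      show "(a, inv b) \<in> (a <#\<^bsub>G\<^esub> C) \<times> (C #> inv b)"
        using a b' lcoset_self rcoset_eq_lcoset by auto
    next
      fix t assume "t \<in> (a <#\<^bsub>G\<^esub> C) \<times> (C #> inv b)"
      then obtain c d where c: "c \<in> C" and d: "d \<in> C" and t: "t = (a \<otimes> c, d \<otimes> inv b)"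
        by (auto simp: l_coset_def r_coset_def)
      have "(c \<otimes> d) \<otimes> inv b \<in> C #> inv b"
        using subgroup.m_closed[OF C_subgroup c d] by (auto simp: r_coset_def)
      then obtain e where e: "e \<in> C" "(c \<otimes> d) \<otimes> inv b = inv b \<otimes> e"
        using rcoset_eq_lcoset[OF b'(1)] by (auto simp: l_coset_def)
      have "(a \<otimes> c) \<otimes> (d \<otimes> inv b) = a \<otimes> ((c \<otimes> d) \<otimes> inv b)"
        using a b' c d C_carrier by (simp add: m_assoc)
      also have "\<dots> = (a \<otimes> inv b) \<otimes> e"
        using a b' e C_carrier by (simp add: m_assoc)
      finally show "(\<lambda>(a, b). (a \<otimes> b) <#\<^bsub>G\<^esub> C) t = (\<lambda>(a, b). (a \<otimes> b) <#\<^bsub>G\<^esub> C) (a, inv b)"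
        using lcoset_mult_C[of "a \<otimes> inv b" e] a b' e by (simp add: t)
    qed
    then show ?thesis
      by (simp add: coset_right_act_def)
  qed
  moreover have "descend (\<lambda>b. conj_act P G b f) (C #> b) = conj_act P G b f"
    using lcoset_self[OF b'(2)] conj_act_coset[OF b'(2) _ f]
    unfolding rcoset_eq_lcoset[OF b] by (intro descend_eq) (auto simp: l_coset_def)
  ultimately show ?thesis
    by (simp add: Weyl_act_def inv_Weyl[OF b])
qed

lemma conj_act_normalizer:
  assumes "b \<in> N" "f \<in> Hom_onto P G U"
  shows "conj_act P G b f \<in> Hom_onto P G U"
  using conj_act_Hom_onto[OF closed, of b f U] assms normalizer_iff[OF U] by simp

lemma Weyl_act_preserves:
  assumes "z \<in> carrier (Weyl G U)" "p \<in> E"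
  shows "Weyl_act P G U z p \<in> E"
    and "phi_map P G (Weyl_act P G U z p) = phi_map P G p"
proof -
  obtain a f where p: "a \<in> carrier G" "f \<in> Hom_onto P G U" "p = (a <#\<^bsub>G\<^esub> C, f)"
    using assms(2) by (rule E_cases)
  obtain b where b: "b \<in> N" "z = C #> b"
    using assms(1) carrier_Weyl by auto
  note bG = N_carrier[OF b(1)] and bf = conj_act_normalizer[OF b(1) p(2)]
  show "Weyl_act P G U z p \<in> E"
    using p b bG bf E_I[of "a \<otimes> inv b"] by (simp add: Weyl_act_eq)
  have "conj_act P G (a \<otimes> inv b) (conj_act P G b f) = conj_act P G a f"
    using conj_act_conj_act[of "a \<otimes> inv b" b f P] p(1) bG Hom_onto_Pi[OF p(2)]
    by (simp add: m_assoc)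
  then show "phi_map P G (Weyl_act P G U z p) = phi_map P G p"
    using p b bG bf by (simp add: Weyl_act_eq phi_map_eq)
qed

text \<open>The element \<open>b = a'\<inverse> a\<close> conjugates \<open>f\<close> to \<open>f'\<close>. As both images are all of \<open>U\<close>, it normalizes
  \<open>U\<close> and so has a class in \<open>Z\<close>.\<close>

lemma phi_map_eq_imp_orbit:
  assumes "p \<in> E" "q \<in> E" and eq: "phi_map P G q = phi_map P G p"
  shows "q \<in> orbit (Weyl G U) (Weyl_act P G U) p"
proof -
  obtain a f where p: "a \<in> carrier G" "f \<in> Hom_onto P G U" "p = (a <#\<^bsub>G\<^esub> C, f)"
    using assms(1) by (rule E_cases)
  obtain a' f' where q: "a' \<in> carrier G" "f' \<in> Hom_onto P G U" "q = (a' <#\<^bsub>G\<^esub> C, f')"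
    using assms(2) by (rule E_cases)
  \<comment> \<open>The only candidate, as \<open>a b\<inverse> = a'\<close> must hold up to \<open>C\<close>.\<close>
  define b where "b = inv a' \<otimes> a"
  have bG: "b \<in> carrier G"
    using p q by (simp add: b_def)
  have "conj_act P G b f = conj_act P G (inv a') (conj_act P G a f)"
    using p q conj_act_conj_act[of "inv a'" a f P] Hom_onto_Pi by (simp add: b_def)
  also have "\<dots> = conj_act P G (inv a') (conj_act P G a' f')"
    using eq p q by (simp add: phi_map_eq)
  also have "\<dots> = f'"
    using q conj_act_conj_act[of "inv a'" a' f' P] conj_act_one[of f' P] Hom_onto_Pi
      Hom_onto_extensional by simp
  finally have bf: "conj_act P G b f = f'" .
  have "f' \<in> Hom_onto P G ((\<lambda>u. b \<otimes> u \<otimes> inv b) ` U)"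
    using conj_act_Hom_onto[OF closed bG p(2)] bf by simp
  then have "(\<lambda>u. b \<otimes> u \<otimes> inv b) ` U = U"
    using q(2) by (simp add: Hom_onto_def)
  then have bN: "b \<in> N"
    using bG normalizer_iff[OF U] by simp
  have "a \<otimes> inv b = a'"
    using p q by (simp add: b_def inv_mult_group flip: m_assoc)
  then have "Weyl_act P G U (C #> b) p = q"
    using p q bf bN by (simp add: Weyl_act_eq)
  then show ?thesis
    using bN carrier_Weyl unfolding orbit_def by blast
qed

lemma orbit_eq_fibre:
  assumes "p \<in> E"
  shows "orbit (Weyl G U) (Weyl_act P G U) p = {q \<in> E. phi_map P G q = phi_map P G p}"
proof (intro equalityI subsetI)
  fix q assume "q \<in> orbit (Weyl G U) (Weyl_act P G U) p"
  then obtain z where "z \<in> carrier (Weyl G U)" "q = Weyl_act P G U z p"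
    by (auto simp: orbit_def)
  then show "q \<in> {q \<in> E. phi_map P G q = phi_map P G p}"
    using Weyl_act_preserves[OF _ assms, of z] by blast
qed (use phi_map_eq_imp_orbit[OF assms] in blast)

lemma phi_bar_orbit:
  assumes "p \<in> E"
  shows "phi_bar P G (orbit (Weyl G U) (Weyl_act P G U) p) = phi_map P G p"
  using assms orbit_eq_fibre[OF assms] unfolding phi_bar_def by (intro descend_eq) auto

lemma phi_bar_bij:
  "bij_betw (phi_bar P G) (balanced_product P G U) (Hom_onto_class P G (conj_class G U))"
  using bij_betw_descend_fibres[of E "orbit (Weyl G U) (Weyl_act P G U)" "phi_map P G"] orbit_eq_fibre
  unfolding phi_bar_def balanced_product_def orbits_def phi_map_image by blast

text \<open>A self-map \<open>\<alpha>\<close> that covers a map \<open>\<beta>\<close> along \<open>\<phi>\<close> maps fibres into fibres, hence orbits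
  into orbits.\<close>

lemma phi_bar_equivariant:
  assumes \<alpha>: "\<And>p. p \<in> E \<Longrightarrow> \<alpha> p \<in> E" "\<And>p. p \<in> E \<Longrightarrow> phi_map P G (\<alpha> p) = \<beta> (phi_map P G p)"
    and "q \<in> balanced_product P G U"
  shows "phi_bar P G (on_orbits P G U \<alpha> q) = \<beta> (phi_bar P G q)"
proof -
  obtain p where p: "p \<in> E" and q: "q = orbit (Weyl G U) (Weyl_act P G U) p"
    using assms(3) by (auto simp: balanced_product_def orbits_def)
  have "on_orbits P G U \<alpha> q = orbit (Weyl G U) (Weyl_act P G U) (\<alpha> p)"
    unfolding on_orbits_def q orbit_eq_fibre[OF p]
  proof (rule descend_eq)
    fix t assume t: "t \<in> {q \<in> E. phi_map P G q = phi_map P G p}"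
    then have "phi_map P G (\<alpha> t) = phi_map P G (\<alpha> p)"
      using \<alpha>(2) p by simp
    then show "orbit (Weyl G U) (Weyl_act P G U) (\<alpha> t) = orbit (Weyl G U) (Weyl_act P G U) (\<alpha> p)"
      using orbit_eq_fibre \<alpha>(1) t p by simp
  qed (use p in simp)
  then show ?thesis
    using \<alpha> p q by (simp add: phi_bar_orbit)
qed

lemma translation_equivariant:
  assumes a: "a \<in> carrier G" and "p \<in> E"
  defines "\<alpha> \<equiv> \<lambda>(aC, f). (a <#\<^bsub>G\<^esub> aC, f)"
  shows "\<alpha> p \<in> E" and "phi_map P G (\<alpha> p) = conj_act P G a (phi_map P G p)"
proof -
  obtain b f where p: "b \<in> carrier G" "f \<in> Hom_onto P G U" "p = (b <#\<^bsub>G\<^esub> C, f)"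
    using assms(2) by (rule E_cases)
  have "\<alpha> p = ((a \<otimes> b) <#\<^bsub>G\<^esub> C, f)"
    using a p C_subgroup by (simp add: \<alpha>_def lcos_m_assoc subgroup.subset)
  then show "\<alpha> p \<in> E" "phi_map P G (\<alpha> p) = conj_act P G a (phi_map P G p)"
    using a p E_I[of "a \<otimes> b" f] Hom_onto_Pi by (simp_all add: phi_map_eq conj_act_conj_act)
qed

text \<open>Precomposition acts on arguments and conjugation on values, so the two commute. Surjectivity of
  \<open>\<sigma>\<close> preserves the image \<open>U\<close>.\<close>

lemma precomposition_equivariant:
  assumes \<sigma>: "\<sigma> \<in> iso P P" and act: "\<And>f. \<mu> f = (\<lambda>c\<in>carrier P. f (\<sigma> c))"
    and "p \<in> E"
  defines "\<alpha> \<equiv> \<lambda>(aC, f). (aC, \<mu> f)"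
  shows "\<alpha> p \<in> E" and "phi_map P G (\<alpha> p) = \<mu> (phi_map P G p)"
proof -
  obtain a f where p: "a \<in> carrier G" "f \<in> Hom_onto P G U" "p = (a <#\<^bsub>G\<^esub> C, f)"
    using assms(3) by (rule E_cases)
  have \<sigma>c: "\<sigma> c \<in> carrier P" if "c \<in> carrier P" for c
    using \<sigma> that by (auto simp: iso_def hom_def)
  have "\<mu> f \<in> hom P G"
    using p(2) \<sigma> \<sigma>c closed by (auto simp: act Hom_onto_def Hom_def hom_def iso_def)
  moreover have "\<mu> f ` carrier P = f ` \<sigma> ` carrier P"
    by (auto simp: act)
  then have "\<mu> f ` carrier P = U"
    using \<sigma> p(2) by (simp add: iso_def bij_betw_def Hom_onto_def)
  ultimately have \<mu>f: "\<mu> f \<in> Hom_onto P G U"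
    by (simp add: Hom_onto_def Hom_def act)
  then show "\<alpha> p \<in> E"
    using p E_I by (simp add: \<alpha>_def)
  have "conj_act P G a (\<mu> f) = \<mu> (conj_act P G a f)"
    using \<sigma>c by (auto simp: conj_act_def act)
  then show "phi_map P G (\<alpha> p) = \<mu> (phi_map P G p)"
    using p \<mu>f by (simp add: \<alpha>_def phi_map_eq)
qed

end

section \<open>Maps induced on the fundamental group\<close>

definition based_loops :: "'m::t2_space set \<Rightarrow> 'm \<Rightarrow> (real \<Rightarrow> 'm) set" where
  "based_loops M x = {\<gamma>. path \<gamma> \<and> path_image \<gamma> \<subseteq> M \<and> pathstart \<gamma> = x \<and> pathfinish \<gamma> = x}"

definition induced :: "'m::t2_space set \<Rightarrow> ('m \<Rightarrow> 'm) \<Rightarrow> (real \<Rightarrow> 'm) set \<Rightarrow> (real \<Rightarrow> 'm) set" where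
  "induced M \<kappa> = descend (\<lambda>\<gamma>. loop_class M (\<kappa> \<circ> \<gamma>))"

lemma carrier_fundamental_group:
  "carrier (fundamental_group M x) = loop_class M ` based_loops M x"
  by (auto simp: fundamental_group_def based_loops_def)

lemma loop_class_cong: "homotopic_paths M \<gamma> \<delta> \<Longrightarrow> loop_class M \<gamma> = loop_class M \<delta>"
  unfolding loop_class_def
  by (intro Collect_cong iffI; erule homotopic_paths_trans[rotated]; simp add: homotopic_paths_sym_eq)

lemma loop_class_self: "\<gamma> \<in> based_loops M x \<Longrightarrow> \<gamma> \<in> loop_class M \<gamma>"
  by (simp add: loop_class_def based_loops_def)

lemma descend_loop_class:
  assumes "\<gamma> \<in> based_loops M x"
    and "\<And>\<delta>. homotopic_paths M \<gamma> \<delta> \<Longrightarrow> h \<delta> = h \<gamma>"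
  shows "descend h (loop_class M \<gamma>) = h \<gamma>"
proof (rule descend_eq[OF loop_class_self[OF assms(1)]])
  show "h \<delta> = h \<gamma>" if "\<delta> \<in> loop_class M \<gamma>" for \<delta>
    using assms(2) that by (simp only: loop_class_def mem_Collect_eq)
qed

lemma join_based_loops:
  "\<gamma> \<in> based_loops M x \<Longrightarrow> \<delta> \<in> based_loops M x \<Longrightarrow> \<gamma> +++ \<delta> \<in> based_loops M x"
  by (auto simp: based_loops_def path_image_join)

lemma mult_fundamental_group:
  assumes "\<gamma> \<in> based_loops M x" "\<delta> \<in> based_loops M x"
  shows "loop_class M \<gamma> \<otimes>\<^bsub>fundamental_group M x\<^esub> loop_class M \<delta> = loop_class M (\<gamma> +++ \<delta>)"
proof -
  have "descend (\<lambda>(\<gamma>, \<delta>). loop_class M (\<gamma> +++ \<delta>)) (loop_class M \<gamma> \<times> loop_class M \<delta>)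
      = (\<lambda>(\<gamma>, \<delta>). loop_class M (\<gamma> +++ \<delta>)) (\<gamma>, \<delta>)"
  proof (rule descend_eq)
    fix t assume "t \<in> loop_class M \<gamma> \<times> loop_class M \<delta>"
    then obtain \<gamma>' \<delta>' where t: "t = (\<gamma>', \<delta>')" and "homotopic_paths M \<gamma> \<gamma>'" "homotopic_paths M \<delta> \<delta>'"
      by (auto simp: loop_class_def)
    then have "homotopic_paths M (\<gamma> +++ \<delta>) (\<gamma>' +++ \<delta>')"
      using assms by (intro homotopic_paths_join) (auto simp: based_loops_def)
    then show "(\<lambda>(\<gamma>, \<delta>). loop_class M (\<gamma> +++ \<delta>)) t = (\<lambda>(\<gamma>, \<delta>). loop_class M (\<gamma> +++ \<delta>)) (\<gamma>, \<delta>)"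
      by (simp add: t loop_class_cong)
  qed (use assms[THEN loop_class_self] in simp)
  then show ?thesis
    by (simp add: fundamental_group_def)
qed

lemma fundamental_group_mult_closed:
  assumes "c \<in> carrier (fundamental_group M x)" "d \<in> carrier (fundamental_group M x)"
  shows "c \<otimes>\<^bsub>fundamental_group M x\<^esub> d \<in> carrier (fundamental_group M x)"
proof -
  obtain \<gamma> \<delta> where "\<gamma> \<in> based_loops M x" "c = loop_class M \<gamma>"
      and "\<delta> \<in> based_loops M x" "d = loop_class M \<delta>"
    using assms unfolding carrier_fundamental_group by blast
  then show ?thesis
    using join_based_loops[of \<gamma> M x \<delta>]
    by (simp add: mult_fundamental_group carrier_fundamental_group)
qed

definition pointed_map :: "'m::t2_space set \<Rightarrow> 'm \<Rightarrow> ('m \<Rightarrow> 'm) \<Rightarrow> bool" where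
  "pointed_map M x \<kappa> \<longleftrightarrow> continuous_on M \<kappa> \<and> \<kappa> \<in> M \<rightarrow> M \<and> \<kappa> x = x"

lemma comp_based_loops:
  assumes "pointed_map M x \<kappa>" "\<gamma> \<in> based_loops M x"
  shows "\<kappa> \<circ> \<gamma> \<in> based_loops M x"
  using assms
  by (auto simp: pointed_map_def based_loops_def path_image_compose pathstart_compose pathfinish_compose
      intro: path_continuous_image continuous_on_subset)

lemma loop_class_comp_cong:
  assumes "pointed_map M x \<kappa>" "homotopic_paths M \<gamma> \<delta>"
  shows "loop_class M (\<kappa> \<circ> \<gamma>) = loop_class M (\<kappa> \<circ> \<delta>)"
  using assms(1)
  by (intro loop_class_cong homotopic_paths_continuous_image[OF assms(2)]) (auto simp: pointed_map_def)

lemma induced_loop_class: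
  assumes "pointed_map M x \<kappa>" "\<gamma> \<in> based_loops M x"
  shows "induced M \<kappa> (loop_class M \<gamma>) = loop_class M (\<kappa> \<circ> \<gamma>)"
  unfolding induced_def
  by (rule descend_loop_class[OF assms(2)], rule loop_class_comp_cong[OF assms(1), symmetric])

lemma induced_hom:
  assumes \<kappa>: "pointed_map M x \<kappa>"
  shows "induced M \<kappa> \<in> hom (fundamental_group M x) (fundamental_group M x)"
proof (rule homI)
  fix c assume "c \<in> carrier (fundamental_group M x)"
  then show "induced M \<kappa> c \<in> carrier (fundamental_group M x)"
    using \<kappa> by (auto simp: carrier_fundamental_group induced_loop_class comp_based_loops)
next
  fix c d assume "c \<in> carrier (fundamental_group M x)" "d \<in> carrier (fundamental_group M x)"
  then show "induced M \<kappa> (c \<otimes>\<^bsub>fundamental_group M x\<^esub> d) =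
      induced M \<kappa> c \<otimes>\<^bsub>fundamental_group M x\<^esub> induced M \<kappa> d"
    using \<kappa> by (auto simp: carrier_fundamental_group induced_loop_class comp_based_loops
        mult_fundamental_group join_based_loops path_compose_join)
qed

text \<open>The two paths agree on the unit interval, but may differ as functions on the reals; hence a
  homotopy instead of an equality.\<close>

lemma homotopic_paths_comp_inverse:
  assumes "\<gamma> \<in> based_loops M x" and "\<And>y. y \<in> M \<Longrightarrow> \<kappa> (\<psi> y) = y"
  shows "homotopic_paths M (\<kappa> \<circ> (\<psi> \<circ> \<gamma>)) \<gamma>"
proof (rule homotopic_paths_sym, rule homotopic_paths_eq)
  show "\<gamma> t = (\<kappa> \<circ> (\<psi> \<circ> \<gamma>)) t" if "t \<in> {0..1}" for t
    using assms that by (auto simp: based_loops_def path_image_def image_subset_iff)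
qed (use assms(1) in \<open>auto simp: based_loops_def\<close>)

lemmas loop_class_comp_inverse = loop_class_cong[OF homotopic_paths_comp_inverse]

lemma induced_iso:
  assumes \<kappa>: "pointed_map M x \<kappa>" and \<psi>: "pointed_map M x \<psi>"
    and inv: "\<And>y. y \<in> M \<Longrightarrow> \<kappa> (\<psi> y) = y" "\<And>y. y \<in> M \<Longrightarrow> \<psi> (\<kappa> y) = y"
  shows "induced M \<kappa> \<in> iso (fundamental_group M x) (fundamental_group M x)"
proof -
  let ?\<pi> = "carrier (fundamental_group M x)"
  have "bij_betw (induced M \<kappa>) ?\<pi> ?\<pi>"
  proof (rule bij_betwI)
    show "induced M \<kappa> \<in> ?\<pi> \<rightarrow> ?\<pi>" "induced M \<psi> \<in> ?\<pi> \<rightarrow> ?\<pi>"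
      using induced_hom[OF \<kappa>] induced_hom[OF \<psi>] by (auto simp: hom_def)
  next
    fix c assume "c \<in> ?\<pi>"
    then show "induced M \<psi> (induced M \<kappa> c) = c" "induced M \<kappa> (induced M \<psi> c) = c"
      using \<kappa> \<psi> inv by (auto simp: carrier_fundamental_group induced_loop_class comp_based_loops
          loop_class_comp_inverse)
  qed
  then show ?thesis
    using induced_hom[OF \<kappa>] by (simp add: iso_def)
qed

section \<open>Isotopic diffeomorphisms induce the same automorphism\<close>

lemma pointed_diffeoD:
  assumes "\<psi> \<in> pointed_diffeos M A x" and "x \<in> M"
  shows "pointed_map M x \<psi>" and "pointed_map M x (inv_into M \<psi>)"
    and "\<And>y. y \<in> M \<Longrightarrow> inv_into M \<psi> (\<psi> y) = y" and "\<And>y. y \<in> M \<Longrightarrow> \<psi> (inv_into M \<psi> y) = y"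
proof -
  have bij: "bij_betw \<psi> M M" and fix_x: "\<psi> x = x"
    using assms by (auto simp: pointed_diffeos_def)
  show l: "inv_into M \<psi> (\<psi> y) = y" if "y \<in> M" for y
    using bij that by (rule bij_betw_inv_into_left)
  show "\<psi> (inv_into M \<psi> y) = y" if "y \<in> M" for y
    using bij that by (rule bij_betw_inv_into_right)
  show "pointed_map M x \<psi>" "pointed_map M x (inv_into M \<psi>)"
    using assms l[OF assms(2)] fix_x by (auto simp: pointed_map_def pointed_diffeos_def smooth_self_map_def)
qed

lemma homotopic_paths_isotopy:
  assumes "(\<psi>, \<psi>') \<in> isotopy M A x" and \<gamma>: "\<gamma> \<in> based_loops M x" and x: "x \<in> M"
  shows "homotopic_paths M (\<psi> \<circ> \<gamma>) (\<psi>' \<circ> \<gamma>)"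
proof -
  obtain F :: "real \<Rightarrow> 'a \<Rightarrow> 'a" where F: "\<And>t. t \<in> {0..1} \<Longrightarrow> F t \<in> pointed_diffeos M A x"
    and cont: "continuous_on ({0..1} \<times> M) (\<lambda>(t, y). F t y)"
    and ends: "\<And>y. y \<in> M \<Longrightarrow> F 0 y = \<psi> y" "\<And>y. y \<in> M \<Longrightarrow> F 1 y = \<psi>' y"
    using assms(1) unfolding isotopy_def by blast
  have \<gamma>M: "\<gamma> s \<in> M" if "s \<in> {0..1}" for s
    using \<gamma> that by (auto simp: based_loops_def path_image_def)
  have cont\<gamma>: "continuous_on {0..1} \<gamma>"
    using \<gamma> by (simp add: based_loops_def path_def)
  have "continuous_on ({0..1} \<times> {0..1}) (\<lambda>p. (\<lambda>(t, y). F t y) (fst p, \<gamma> (snd p)))"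
    using \<gamma>M
    by (intro continuous_on_compose2[OF cont] continuous_intros continuous_on_compose2[OF cont\<gamma>]) auto
  then have "continuous_on ({0..1} \<times> {0..1}) (\<lambda>p. F (fst p) (\<gamma> (snd p)))"
    by simp
  moreover have F_M: "F t y \<in> M" and F_x: "F t x = x" if "t \<in> {0..1}" "y \<in> M" for t y
    using pointed_diffeoD(1)[OF F[OF that(1)] x] that by (auto simp: pointed_map_def)
  moreover have "\<psi> x = x" "\<psi>' x = x"
    using F_x[OF _ x, of 0] F_x[OF _ x, of 1] ends[OF x] by auto
  ultimately show ?thesis
    using \<gamma> \<gamma>M x ends unfolding homotopic_paths
    by (intro exI[of _ "\<lambda>p. F (fst p) (\<gamma> (snd p))"])
      (auto simp: based_loops_def pathstart_def pathfinish_def)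
qed

text \<open>An isotopy from \<open>\<psi>\<close> to \<open>\<psi>'\<close> gives a homotopy from \<open>\<psi> \<circ> \<alpha>\<close> to \<open>\<psi>' \<circ> \<alpha>\<close>, whereas the action involves the
  inverses. The passage from the one to the other is algebraic: for \<open>\<alpha> = \<psi>'\<inverse> \<circ> \<gamma>\<close>,
  \<open>\<alpha> \<simeq> \<psi>\<inverse> \<circ> \<psi> \<circ> \<alpha> \<simeq> \<psi>\<inverse> \<circ> \<psi>' \<circ> \<alpha> \<simeq> \<psi>\<inverse> \<circ> \<gamma>\<close>.\<close>

lemma loop_class_inverse_isotopic:
  assumes iso: "(\<psi>, \<psi>') \<in> isotopy M A x" and \<gamma>: "\<gamma> \<in> based_loops M x" and x: "x \<in> M"
  shows "loop_class M (inv_into M \<psi>' \<circ> \<gamma>) = loop_class M (inv_into M \<psi> \<circ> \<gamma>)"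
proof -
  have \<psi>: "\<psi> \<in> pointed_diffeos M A x" and \<psi>': "\<psi>' \<in> pointed_diffeos M A x"
    using iso by (auto simp: isotopy_def)
  let ?\<kappa> = "inv_into M \<psi>" and ?\<alpha> = "inv_into M \<psi>' \<circ> \<gamma>"
  have \<alpha>: "?\<alpha> \<in> based_loops M x"
    using comp_based_loops[OF pointed_diffeoD(2)[OF \<psi>' x] \<gamma>] .
  have "loop_class M ?\<alpha> = loop_class M (?\<kappa> \<circ> (\<psi> \<circ> ?\<alpha>))"
    using loop_class_comp_inverse[OF \<alpha>] pointed_diffeoD(3)[OF \<psi> x] by metis
  also have "\<dots> = loop_class M (?\<kappa> \<circ> (\<psi>' \<circ> ?\<alpha>))"
    using homotopic_paths_isotopy[OF iso \<alpha> x] pointed_diffeoD(2)[OF \<psi> x] by (intro loop_class_comp_cong)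
  also have "\<dots> = loop_class M (?\<kappa> \<circ> \<gamma>)"
    by (intro loop_class_comp_cong[OF pointed_diffeoD(2)[OF \<psi> x]]
        homotopic_paths_comp_inverse[OF \<gamma>] pointed_diffeoD(4)[OF \<psi>' x])
  finally show ?thesis .
qed

section \<open>The constant isotopy\<close>

text \<open>Isotopy must be reflexive for the class of \<open>\<psi>\<close> to contain \<open>\<psi>\<close>, and so for the action of that class
  to be given by \<open>\<psi>\<close>. What has to be shown is that the constant isotopy is smooth jointly in time and
  position, that is, that smoothness is preserved by composition with the projection from the
  product with the time axis.

  In the next lemma the openness of \<open>S\<close> is what makes the derivatives at points of \<open>S\<close> depend on
  the values on \<open>S\<close> alone.\<close>

lemma Ck_on_cong:
  assumes "open S" and "\<And>p. p \<in> S \<Longrightarrow> f p = g p" and "Ck_on k S f"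
  shows "Ck_on k S g"
  using assms(2,3)
proof (induction k arbitrary: f g)
  case 0
  then show ?case
    using continuous_on_cong[of S S f g] by simp
next
  case (Suc k)
  have der: "(g has_derivative frechet_derivative f (at p)) (at p)" if "p \<in> S" for p
    using Suc.prems that assms(1) frechet_derivative_works has_derivative_transform_within_open
    by (metis Ck_on.simps(2))
  then have "frechet_derivative f (at p) v = frechet_derivative g (at p) v" if "p \<in> S" for p v
    using that frechet_derivative_at by metis
  then have "Ck_on k S (\<lambda>p. frechet_derivative g (at p) v)" for v
    using Suc.IH[of "\<lambda>p. frechet_derivative f (at p) v"] Suc.prems by simp
  then show ?case
    using der by (auto simp: differentiable_def)
qed

text \<open>The derivative of \<open>f \<circ> snd\<close> in direction \<open>v\<close> is again of the form \<open>g \<circ> snd\<close>, with \<open>g\<close> the derivative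
  of \<open>f\<close> in direction \<open>snd v\<close>, so the induction hypothesis applies to it.\<close>

lemma Ck_on_comp_snd:
  fixes f :: "'a::real_normed_vector \<Rightarrow> 'b::real_normed_vector"
  assumes "open T" and "Ck_on k T f"
  shows "Ck_on k (UNIV \<times> T) (\<lambda>p::'c::real_normed_vector \<times> 'a. f (snd p))"
  using assms(2)
proof (induction k arbitrary: f)
  case 0
  then show ?case
    by (auto intro!: continuous_on_compose2[of T f] continuous_intros)
next
  case (Suc k)
  have der: "((\<lambda>p::'c \<times> 'a. f (snd p)) has_derivative (\<lambda>v. frechet_derivative f (at (snd p)) (snd v))) (at p)"
    if "p \<in> UNIV \<times> T" for p
  proof -
    have "(f has_derivative frechet_derivative f (at (snd p))) (at (snd p))"
      using Suc.prems that frechet_derivative_works by fastforce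
    then show ?thesis
      by (intro has_derivative_compose[where f = snd and g = f] has_derivative_snd has_derivative_ident)
  qed
  have "Ck_on k (UNIV \<times> T) (\<lambda>p. frechet_derivative (\<lambda>p::'c \<times> 'a. f (snd p)) (at p) v)" for v
  proof (rule Ck_on_cong)
    show "open ((UNIV :: 'c set) \<times> T)"
      using assms(1) by (intro open_Times) auto
    show "Ck_on k (UNIV \<times> T) (\<lambda>p::'c \<times> 'a. frechet_derivative f (at (snd p)) (snd v))"
      using Suc.IH[of "\<lambda>y. frechet_derivative f (at y) (snd v)"] Suc.prems by simp
    show "frechet_derivative f (at (snd p)) (snd v) = frechet_derivative (\<lambda>p::'c \<times> 'a. f (snd p)) (at p) v"
      if "p \<in> UNIV \<times> T" for p
      using frechet_derivative_at[OF der[OF that]] by metis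
  qed
  moreover have "(\<lambda>p::'c \<times> 'a. f (snd p)) differentiable (at p)" if "p \<in> UNIV \<times> T" for p
    using der[OF that] by (rule differentiableI)
  ultimately show ?case
    by simp
qed

lemma smooth_on_comp_snd:
  assumes "smooth_on S f"
  shows "smooth_on (I \<times> S) (\<lambda>p::real \<times> _. f (snd p))"
  unfolding smooth_on_def
proof
  fix p assume "p \<in> I \<times> S"
  then obtain T f' where "open T" "snd p \<in> T" "\<forall>k. Ck_on k T f'" "\<forall>q\<in>S \<inter> T. f' q = f q"
    using assms unfolding smooth_on_def by force
  then show "\<exists>T f'. open T \<and> p \<in> T \<and> (\<forall>k. Ck_on k T f') \<and> (\<forall>q\<in>(I \<times> S) \<inter> T. f' q = f (snd q))"
    by (intro exI[of _ "UNIV \<times> T"] exI[of _ "\<lambda>p. f' (snd p)"])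
      (auto simp: Ck_on_comp_snd open_Times mem_Times_iff)
qed

lemma isotopy_refl:
  assumes atlas: "oriented_atlas M A" and \<psi>: "\<psi> \<in> pointed_diffeos M A x"
  shows "(\<psi>, \<psi>) \<in> isotopy M A x"
proof -
  have smooth: "smooth_self_map M A \<psi>"
    using \<psi> by (simp add: pointed_diffeos_def)
  have "continuous_on ({0..1} \<times> M) (\<lambda>(t::real, y). \<psi> y)"
    using smooth unfolding smooth_self_map_def case_prod_unfold
    by (auto intro!: continuous_on_compose2[of M \<psi>] continuous_intros)
  moreover have "smooth_on {(t::real, y). t \<in> {0..1} \<and> y \<in> h ` U \<and> \<psi> (inv_into U h y) \<in> V}
      (\<lambda>(t, y). k (\<psi> (inv_into U h y)))" if "(U, h) \<in> A" "(V, k) \<in> A" for U h V k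
  proof -
    \<comment> \<open>Injectivity of the chart identifies the domain in the definition of isotopy with that of the coordinate representation.\<close>
    have "inj_on h U"
      using atlas that(1) by (force simp: oriented_atlas_def chart_on_def homeomorphism_def intro: inj_on_inverseI)
    then have dom: "coord_dom \<psi> (U, h) (V, k) = {y \<in> h ` U. \<psi> (inv_into U h y) \<in> V}"
      by (auto simp: coord_dom_def)
    have "smooth_on ({0..1} \<times> coord_dom \<psi> (U, h) (V, k)) (\<lambda>p::real \<times> _. coord_rep \<psi> (U, h) (V, k) (snd p))"
      using smooth that by (intro smooth_on_comp_snd) (auto simp: smooth_self_map_def)
    moreover have "{0..1} \<times> coord_dom \<psi> (U, h) (V, k)
        = {(t::real, y). t \<in> {0..1} \<and> y \<in> h ` U \<and> \<psi> (inv_into U h y) \<in> V}"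
      by (auto simp: dom)
    ultimately show ?thesis
      by (simp add: coord_rep_def case_prod_unfold)
  qed
  ultimately show ?thesis
    unfolding isotopy_def using \<psi> by (auto intro!: exI[of _ "\<lambda>t. \<psi>"])
qed

section \<open>The mapping class group acts by precomposition\<close>

text \<open>The automorphism is the one induced by the inverse of any representative of \<open>\<Phi>\<close>.\<close>

lemma mcg_act_eq_precomposition:
  assumes atlas: "oriented_atlas M A" and x: "x \<in> M"
    and \<Phi>: "\<Phi> \<in> carrier (mapping_class_group M A x)"
  obtains \<sigma> where "\<sigma> \<in> iso (fundamental_group M x) (fundamental_group M x)"
    and "\<And>f. mcg_act M x \<Phi> f = (\<lambda>c\<in>carrier (fundamental_group M x). f (\<sigma> c))"
proof -
  obtain \<psi> where \<psi>: "\<psi> \<in> pointed_diffeos M A x" and \<Phi>_eq: "\<Phi> = isotopy M A x `` {\<psi>}"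
    using \<Phi> by (auto simp: mapping_class_group_def quotient_def)
  let ?\<pi> = "carrier (fundamental_group M x)"
  let ?pull = "\<lambda>f \<psi>. \<lambda>c\<in>?\<pi>. descend (\<lambda>\<gamma>. f (loop_class M (inv_into M \<psi> \<circ> \<gamma>))) c"
  have pull: "descend (\<lambda>\<gamma>. f (loop_class M (inv_into M \<psi>' \<circ> \<gamma>))) (loop_class M \<gamma>)
      = f (loop_class M (inv_into M \<psi>' \<circ> \<gamma>))"
    if "\<psi>' \<in> pointed_diffeos M A x" "\<gamma> \<in> based_loops M x" for f :: "_ \<Rightarrow> 'b" and \<psi>' \<gamma>
    using loop_class_comp_cong[OF pointed_diffeoD(2)[OF that(1) x]] that
    by (intro descend_loop_class) (auto intro: arg_cong[of _ _ f])
  show thesis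
  proof
    show "induced M (inv_into M \<psi>) \<in> iso (fundamental_group M x) (fundamental_group M x)"
      using pointed_diffeoD[OF \<psi> x] by (intro induced_iso)
  next
    fix f :: "(real \<Rightarrow> 'a) set \<Rightarrow> 'b"
    have "mcg_act M x \<Phi> f = ?pull f \<psi>"
      unfolding mcg_act_def
    proof (rule descend_eq)
      show "\<psi> \<in> \<Phi>"
        using isotopy_refl[OF atlas \<psi>] by (simp add: \<Phi>_eq)
    next
      fix \<psi>' assume "\<psi>' \<in> \<Phi>"
      then have iso: "(\<psi>, \<psi>') \<in> isotopy M A x"
        by (simp add: \<Phi>_eq)
      then have "\<psi>' \<in> pointed_diffeos M A x"
        by (simp add: isotopy_def)
      then show "?pull f \<psi>' = ?pull f \<psi>"
        using pull \<psi> loop_class_inverse_isotopic[OF iso _ x]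
        by (auto simp: carrier_fundamental_group intro!: restrict_ext)
    qed
    also have "\<dots> = (\<lambda>c\<in>?\<pi>. f (induced M (inv_into M \<psi>) c))"
      using pull[OF \<psi>] induced_loop_class[OF pointed_diffeoD(2)[OF \<psi> x]]
      by (auto simp: carrier_fundamental_group intro!: restrict_ext)
    finally show "mcg_act M x \<Phi> f = (\<lambda>c\<in>?\<pi>. f (induced M (inv_into M \<psi>) c))" .
  qed
qed

section \<open>The equivariant bijection\<close>

theorem proposition6p1:
  fixes G :: "('g, 'h) monoid_scheme" and U :: "'g set" and g :: nat
    and M :: "'m::t2_space set" and A :: "'m chart set" and x :: 'm
    and P :: "(real \<Rightarrow> 'm) set monoid" and C :: "'g set" and Om_U Om_O :: "((real \<Rightarrow> 'm) set \<Rightarrow> 'g) set"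
  assumes "group G" and "finite (carrier G)" and "subgroup U G"
    and "closed_oriented_surface M A g" and "x \<in> M"
    and "P = fundamental_group M x"
    and "C = centralizer G U"
    and "Om_U = Hom_onto P G U"
    and "Om_O = Hom_onto_class P G (conj_class G U)"
  shows "phi_map P G \<in> (lcosets\<^bsub>G\<^esub> C) \<times> Om_U \<rightarrow> Om_O \<and>
    (\<forall>z\<in>carrier (Weyl G U). \<forall>p\<in>(lcosets\<^bsub>G\<^esub> C) \<times> Om_U.
       phi_map P G (Weyl_act P G U z p) = phi_map P G p) \<and>
    bij_betw (phi_bar P G) (balanced_product P G U) Om_O \<and>
    (\<forall>a\<in>carrier G. \<forall>q\<in>balanced_product P G U.
       phi_bar P G (on_orbits P G U (\<lambda>(aC, f). (a <#\<^bsub>G\<^esub> aC, f)) q)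
         = conj_act P G a (phi_bar P G q)) \<and>
    (\<forall>\<Phi>\<in>carrier (mapping_class_group M A x). \<forall>q\<in>balanced_product P G U.
       phi_bar P G (on_orbits P G U (\<lambda>(aC, f). (aC, mcg_act M x \<Phi> f)) q)
         = mcg_act M x \<Phi> (phi_bar P G q))"
proof -
  interpret homs_onto_conjugates G P U
    using assms(1,3) fundamental_group_mult_closed subgroup.subset[OF assms(3)]
    by (auto simp: homs_onto_conjugates_def homs_onto_conjugates_axioms_def assms(6))
  have atlas: "oriented_atlas M A"
    using assms(4) by (simp add: closed_oriented_surface_def)
  have mcg: "phi_bar P G (on_orbits P G U (\<lambda>(aC, f). (aC, mcg_act M x \<Phi> f)) q)
      = mcg_act M x \<Phi> (phi_bar P G q)"
    if \<Phi>: "\<Phi> \<in> carrier (mapping_class_group M A x)" and q: "q \<in> balanced_product P G U" for \<Phi> q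
  proof -
    obtain \<sigma> where "\<sigma> \<in> iso P P"
      and "\<And>f::_ \<Rightarrow> 'g. mcg_act M x \<Phi> f = (\<lambda>c\<in>carrier P. f (\<sigma> c))"
      using mcg_act_eq_precomposition[OF atlas assms(5) \<Phi>] unfolding assms(6) by metis
    from precomposition_equivariant[OF this] show ?thesis
      by (intro phi_bar_equivariant q)
  qed
  have translation: "phi_bar P G (on_orbits P G U (\<lambda>(aC, f). (a <#\<^bsub>G\<^esub> aC, f)) q)
      = conj_act P G a (phi_bar P G q)"
    if "a \<in> carrier G" "q \<in> balanced_product P G U" for a q
    using translation_equivariant[OF that(1)] that(2) by (intro phi_bar_equivariant)
  show ?thesis
    unfolding assms(7-9)
    by (intro conjI ballI funcsetI phi_map_in_conj_class Weyl_act_preserves(2) phi_bar_bij translation mcg)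
qed

end
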